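(* Let $n_3,n_4,k\in\mathbb{N}$. If $k\ge 3$, then $P_2\square P_2\square P_{n_3}\square P_{n_4}$ is equitably $k$-list arborable.
   Context: $P_n$ denotes the path on $n$ vertices and $\square$ the Cartesian product. A $k$-uniform list assignment $L$ for $G$ assigns to each vertex $v$ a set $L(v)$ of exactly $k$ colours; an $L$-colouring is a map $c$ with $c(v)\in L(v)$; it is equitable if every colour class has at most $\lceil |V(G)|/k\rceil$ vertices. $G$ is equitably $k$-list arborable if for every $k$-uniform list assignment $L$ there is an equitable $L$-colouring of $G$ in which every colour class induces an acyclic subgraph. *)

theory Defs
  imports Complex_Main
begin

record 'a graph =
  verts :: "'a set"
  adj :: "'a \<Rightarrow> 'a \<Rightarrow> bool"

definition simple_graph :: "'a graph \<Rightarrow> bool" where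
  "simple_graph G \<longleftrightarrow>
     finite (verts G) \<and>
     (\<forall>u v. adj G u v \<longrightarrow> u \<in> verts G \<and> v \<in> verts G \<and> u \<noteq> v \<and> adj G v u)"

text \<open>\<open>path_graph 0\<close> is the graph without vertices.\<close>

definition path_graph :: "nat \<Rightarrow> nat graph" where
  "path_graph n =
     \<lparr>verts = {..<n}, adj = (\<lambda>i j. i < n \<and> j < n \<and> (j = Suc i \<or> i = Suc j))\<rparr>"

definition cartesian_product :: "'a graph \<Rightarrow> 'b graph \<Rightarrow> ('a \<times> 'b) graph" (infixr "\<box>" 80) where
  "G \<box> H =
     \<lparr>verts = verts G \<times> verts H,
      adj = (\<lambda>(u, x) (v, y).
        (u = v \<and> u \<in> verts G \<and> adj H x y) \<or> (adj G u v \<and> x = y \<and> x \<in> verts H))\<rparr>"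

definition induced_subgraph :: "'a graph \<Rightarrow> 'a set \<Rightarrow> 'a graph" where
  "induced_subgraph G S =
     \<lparr>verts = verts G \<inter> S, adj = (\<lambda>u v. u \<in> S \<and> v \<in> S \<and> adj G u v)\<rparr>"

text \<open>A cycle is the list of its vertices in cyclic order; the starting vertex is not repeated
  at the end.\<close>

definition is_cycle :: "'a graph \<Rightarrow> 'a list \<Rightarrow> bool" where
  "is_cycle G p \<longleftrightarrow>
     length p \<ge> 3 \<and> distinct p \<and> set p \<subseteq> verts G \<and>
     (\<forall>i. Suc i < length p \<longrightarrow> adj G (p ! i) (p ! Suc i)) \<and> adj G (last p) (hd p)"

definition acyclic_graph :: "'a graph \<Rightarrow> bool" where
  "acyclic_graph G \<longleftrightarrow> (\<nexists>p. is_cycle G p)"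

definition uniform_list_assignment :: "nat \<Rightarrow> 'a graph \<Rightarrow> ('a \<Rightarrow> 'c set) \<Rightarrow> bool" where
  "uniform_list_assignment k G L \<longleftrightarrow> (\<forall>v \<in> verts G. finite (L v) \<and> card (L v) = k)"

definition list_colouring :: "'a graph \<Rightarrow> ('a \<Rightarrow> 'c set) \<Rightarrow> ('a \<Rightarrow> 'c) \<Rightarrow> bool" where
  "list_colouring G L c \<longleftrightarrow> (\<forall>v \<in> verts G. c v \<in> L v)"

definition colour_class :: "'a graph \<Rightarrow> ('a \<Rightarrow> 'c) \<Rightarrow> 'c \<Rightarrow> 'a set" where
  "colour_class G c a = {v \<in> verts G. c v = a}"

definition equitable_colouring :: "nat \<Rightarrow> 'a graph \<Rightarrow> ('a \<Rightarrow> 'c) \<Rightarrow> bool" where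
  "equitable_colouring k G c \<longleftrightarrow>
     (\<forall>a. int (card (colour_class G c a)) \<le> \<lceil>real (card (verts G)) / real k\<rceil>)"

text \<open>The type of colours is an explicit parameter, because a definition cannot quantify over
  types.\<close>

definition equitably_list_arborable :: "'c itself \<Rightarrow> nat \<Rightarrow> 'a graph \<Rightarrow> bool" where
  "equitably_list_arborable (colours :: 'c itself) k G \<longleftrightarrow>
     (\<forall>L :: 'a \<Rightarrow> 'c set. uniform_list_assignment k G L \<longrightarrow>
        (\<exists>c. list_colouring G L c \<and> equitable_colouring k G c \<and>
             (\<forall>a. acyclic_graph (induced_subgraph G (colour_class G c a)))))"

lemma simple_graph_path_graph: "simple_graph (path_graph n)"
  by (auto simp: simple_graph_def path_graph_def)

lemma simple_graph_cartesian_product: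
  "simple_graph G \<Longrightarrow> simple_graph H \<Longrightarrow> simple_graph (G \<box> H)"
  by (auto simp: simple_graph_def cartesian_product_def)

lemma simple_graph_induced_subgraph:
  "simple_graph G \<Longrightarrow> simple_graph (induced_subgraph G S)"
  by (auto simp: simple_graph_def induced_subgraph_def)

end

theory Submission
  imports Defs
begin

text \<open>
  The vertices are coloured in groups of at most \<open>k\<close>, each group receiving pairwise distinct
  colours. A new vertex with at most one earlier neighbour of its own colour closes no
  monochromatic cycle, so a colour is forbidden only if it occurs twice among the earlier
  neighbours. Hence a group can be coloured greedily when its \<open>i\<close>-th vertex, counted from the end,
  has fewer than \<open>2 * i\<close> earlier neighbours.

  The graph consists of copies of the four-cycle \<open>P\<^sub>2 \<box> P\<^sub>2\<close>, each joined to at most two earlier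
  copies. For \<open>k \<ge> 5\<close> any \<open>k\<close> consecutive vertices form a greedy group, and for \<open>k = 4\<close> two copies
  split into two greedy groups. For \<open>k = 3\<close> the greedy condition fails for every choice of the last
  group, since the minimum degree is 4. Three copies split into three greedy groups and a path
  \<open>u, v, w\<close> whose vertices have two admissible colours each. If these are the same \<open>p, q\<close> for all
  three and both colours are used up, the fourth vertex \<open>z\<close> of the last copy and an earlier
  neighbour of \<open>u\<close> are forced to share a third colour \<open>r\<close>. Giving \<open>r\<close> to \<open>u\<close> as well is then safe,
  because \<open>z\<close> becomes a leaf of its colour class.
\<close>

section \<open>Partial colourings with acyclic classes and their greedy extension\<close>

text \<open>The bound \<open>b\<close> is a free parameter so that it can grow by one per group
  while \<open>W\<close> is built up.\<close>

definition forest_colouring ::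
  "'a graph \<Rightarrow> ('a \<Rightarrow> 'c set) \<Rightarrow> 'a set \<Rightarrow> nat \<Rightarrow> ('a \<Rightarrow> 'c) \<Rightarrow> bool" where
  "forest_colouring G L W b c \<longleftrightarrow>
     (\<forall>v\<in>W. c v \<in> L v) \<and>
     (\<forall>a. acyclic_graph (induced_subgraph G {v \<in> W. c v = a}) \<and> card {v \<in> W. c v = a} \<le> b)"

text \<open>The colours that \<open>acyclic_insert\<close> permits at \<open>y\<close> once
  \<open>W\<close> is coloured.\<close>

definition available :: "'a graph \<Rightarrow> ('a \<Rightarrow> 'c set) \<Rightarrow> 'a set \<Rightarrow> ('a \<Rightarrow> 'c) \<Rightarrow> 'a \<Rightarrow> 'c set" where
  "available G L W c y =
     {a \<in> L y. \<forall>w\<in>W. \<forall>w'\<in>W. adj G y w \<and> adj G y w' \<and> c w = a \<and> c w' = a \<longrightarrow> w = w'}"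

lemma acyclic_induced_subset:
  assumes "acyclic_graph (induced_subgraph G S)" "T \<subseteq> S"
  shows "acyclic_graph (induced_subgraph G T)"
proof -
  have "is_cycle (induced_subgraph G S) p" if "is_cycle (induced_subgraph G T) p" for p
    using that assms(2) unfolding is_cycle_def induced_subgraph_def by auto
  then show ?thesis using assms(1) unfolding acyclic_graph_def by blast
qed

lemma cycle_two_neighbours:
  assumes cyc: "is_cycle G p" and x: "x \<in> set p" and sym: "\<And>u v. adj G u v \<Longrightarrow> adj G v u"
  obtains y z where "y \<in> set p" "z \<in> set p" "y \<noteq> z" "y \<noteq> x" "z \<noteq> x" "adj G x y" "adj G x z"
proof -
  define n where "n = length p"
  have n: "n \<ge> 3" and d: "distinct p" and lh: "adj G (last p) (hd p)"
    and step: "\<And>i. Suc i < n \<Longrightarrow> adj G (p ! i) (p ! Suc i)"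
    using cyc by (auto simp: is_cycle_def n_def)
  have ne: "p \<noteq> []" using n n_def by auto
  have lh': "adj G (p ! (n - 1)) (p ! 0)"
    using lh ne by (simp add: last_conv_nth hd_conv_nth n_def)
  obtain i where i: "i < n" "x = p ! i" using x by (auto simp: in_set_conv_nth n_def)
  \<comment> \<open>Indices of the successor and predecessor of \<open>x\<close>, wrapping around;
    they differ because a cycle has length at least 3.\<close>
  define j where "j = (if Suc i < n then Suc i else 0)"
  define l where "l = (if i = 0 then n - 1 else i - 1)"
  have jl: "j < n" "l < n" "j \<noteq> l" "j \<noteq> i" "l \<noteq> i"
    using n i by (auto simp: j_def l_def split: if_splits)
  have "adj G x (p ! j)"
  proof (cases "Suc i < n")
    case True
    then show ?thesis using step i j_def by simp
  next
    case False
    then have "i = n - 1" using i by simp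
    then show ?thesis using lh' i False j_def by simp
  qed
  moreover have "adj G x (p ! l)"
  proof (cases "i = 0")
    case True
    then show ?thesis using sym[OF lh'] i l_def by simp
  next
    case False
    then show ?thesis using sym[OF step[of "i - 1"]] i l_def by simp
  qed
  ultimately show ?thesis
    using that[of "p ! j" "p ! l"] jl d i by (simp add: nth_eq_iff_index_eq n_def)
qed

text \<open>A cycle through \<open>x\<close> would give \<open>x\<close> two distinct neighbours in
  \<open>S\<close>, and a cycle avoiding \<open>x\<close> lies in \<open>S\<close> already.\<close>

lemma acyclic_insert:
  assumes ac: "acyclic_graph (induced_subgraph G S)"
    and sym: "\<And>u v. adj G u v \<Longrightarrow> adj G v u"
    and one: "\<And>y z. y \<in> S \<Longrightarrow> z \<in> S \<Longrightarrow> adj G x y \<Longrightarrow> adj G x z \<Longrightarrow> y = z"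
  shows "acyclic_graph (induced_subgraph G (insert x S))"
  unfolding acyclic_graph_def
proof
  assume "\<exists>p. is_cycle (induced_subgraph G (insert x S)) p"
  then obtain p where p: "is_cycle (induced_subgraph G (insert x S)) p" by blast
  show False
  proof (cases "x \<in> set p")
    case True
    obtain y z where yz: "y \<in> set p" "z \<in> set p" "y \<noteq> z" "y \<noteq> x" "z \<noteq> x"
      and adj: "adj (induced_subgraph G (insert x S)) x y" "adj (induced_subgraph G (insert x S)) x z"
      by (rule cycle_two_neighbours[OF p True]) (auto simp: induced_subgraph_def sym)
    then show False using one[of y z] by (auto simp: induced_subgraph_def)
  next
    case False
    have sub: "set p \<subseteq> S" using p False by (auto simp: is_cycle_def induced_subgraph_def)
    then have "p \<noteq> [] \<Longrightarrow> last p \<in> S \<and> hd p \<in> S" by auto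
    moreover have "p \<noteq> []" using p by (auto simp: is_cycle_def)
    ultimately have "is_cycle (induced_subgraph G S) p"
      using p sub by (auto simp: is_cycle_def induced_subgraph_def subset_iff)
    then show False using ac by (auto simp: acyclic_graph_def)
  qed
qed

text \<open>The fibres of \<open>c\<close> over repeated colours are disjoint subsets of
  \<open>N\<close> with at least two elements each.\<close>

lemma two_card_repeated:
  assumes "finite N"
  shows "2 * card {a. \<exists>w\<in>N. \<exists>w'\<in>N. w \<noteq> w' \<and> c w = a \<and> c w' = a} \<le> card N"
proof -
  let ?D = "{a. \<exists>w\<in>N. \<exists>w'\<in>N. w \<noteq> w' \<and> c w = a \<and> c w' = a}"
  have fD: "finite ?D" by (rule finite_subset[of _ "c ` N"]) (use assms in auto)
  have two: "2 \<le> card {w \<in> N. c w = a}" if a: "a \<in> ?D" for a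
  proof -
    from a obtain w w' where "w \<in> N" "w' \<in> N" "w \<noteq> w'" "c w = a" "c w' = a" by blast
    then have "{w, w'} \<subseteq> {w \<in> N. c w = a}" "card {w, w'} = 2" by auto
    then show ?thesis using card_mono[of "{w \<in> N. c w = a}" "{w, w'}"] assms by auto
  qed
  have "2 * card ?D = (\<Sum>a\<in>?D. 2)" by simp
  also have "\<dots> \<le> (\<Sum>a\<in>?D. card {w \<in> N. c w = a})" by (intro sum_mono two)
  also have "\<dots> = card (\<Union>a\<in>?D. {w \<in> N. c w = a})"
    by (rule card_UN_disjoint[symmetric]) (use fD assms in auto)
  also have "\<dots> \<le> card N" by (rule card_mono) (use assms in auto)
  finally show ?thesis .
qed

text \<open>Fewer than \<open>2 * (k - j)\<close> neighbours repeat fewer than \<open>k - j\<close>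
  colours, so more than \<open>j\<close> of the \<open>k\<close> survive. The list \<open>xs\<close>
  may overcount the neighbours.\<close>

lemma card_available:
  assumes nb: "{w \<in> W. adj G y w} \<subseteq> set xs" "length xs < 2 * (k - j)"
    and L: "finite (L y)" "card (L y) = k"
  shows "j < card (available G L W c y)"
proof -
  let ?N = "{w \<in> W. adj G y w}"
  let ?D = "{a. \<exists>w\<in>?N. \<exists>w'\<in>?N. w \<noteq> w' \<and> c w = a \<and> c w' = a}"
  have fin: "finite ?N" by (rule finite_subset[OF nb(1)]) simp
  have "available G L W c y = L y - ?D" by (auto simp: available_def)
  then have "card (L y) - card ?D \<le> card (available G L W c y)"
    using diff_card_le_card_Diff[of ?D "L y"] finite_subset[of ?D "c ` ?N"] fin by auto
  moreover have "2 * card ?D \<le> card ?N" using two_card_repeated[OF fin] .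
  moreover have "card ?N \<le> length xs"
    using card_mono[OF _ nb(1)] card_length[of xs] by simp
  ultimately show ?thesis using nb(2) L(2) by linarith
qed

text \<open>Greedy choice in list order: the \<open>j\<close> representatives chosen before cannot
  exhaust more than \<open>j\<close> candidates.\<close>

lemma distinct_representatives:
  assumes "distinct ys" "\<And>j. j < length ys \<Longrightarrow> j < card (A (ys ! j))"
  shows "\<exists>d. inj_on d (set ys) \<and> (\<forall>y\<in>set ys. d y \<in> A y)"
  using assms
proof (induction ys rule: rev_induct)
  case Nil
  then show ?case by simp
next
  case (snoc y ys)
  have "j < card (A (ys ! j))" if "j < length ys" for j
    using snoc.prems(2)[of j] that by (simp add: nth_append)
  then obtain d where d: "inj_on d (set ys)" "\<forall>y\<in>set ys. d y \<in> A y"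
    using snoc.IH snoc.prems(1) by auto
  have "length ys < card (A y)" using snoc.prems(2)[of "length ys"] by simp
  moreover have "card (d ` set ys) \<le> length ys"
    using card_image_le[of "set ys" d] card_length[of ys] by simp
  ultimately have "\<not> A y \<subseteq> d ` set ys" using card_mono[of "d ` set ys" "A y"] by auto
  then obtain a where a: "a \<in> A y" "a \<notin> d ` set ys" by auto
  have y: "y \<notin> set ys" using snoc.prems(1) by simp
  let ?d = "d(y := a)"
  have "inj_on ?d (set (ys @ [y]))" using d(1) a(2) y by (auto simp: inj_on_def)
  moreover have "\<forall>x\<in>set (ys @ [y]). ?d x \<in> A x" using d(2) a(1) y by auto
  ultimately show ?case by blast
qed

text \<open>As \<open>d\<close> is injective on \<open>T\<close>, each class gains at most one
  vertex. Edges inside \<open>T\<close> are therefore never monochromatic, and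
  \<open>acyclic_insert\<close> suffices.\<close>

lemma extend_rainbow:
  assumes c: "forest_colouring G L W b c"
    and sym: "\<And>u v. adj G u v \<Longrightarrow> adj G v u"
    and T: "W \<inter> T = {}" and d: "inj_on d T" "\<And>y. y \<in> T \<Longrightarrow> d y \<in> available G L W c y"
    and fin: "finite W"
  shows "forest_colouring G L (W \<union> T) (b + 1) (\<lambda>v. if v \<in> W then c v else d v)"
proof -
  let ?c = "\<lambda>v. if v \<in> W then c v else d v"
  have "?c v \<in> L v" if "v \<in> W \<union> T" for v
    using that c d(2)[of v] by (auto simp: forest_colouring_def available_def)
  moreover have "acyclic_graph (induced_subgraph G {v \<in> W \<union> T. ?c v = a}) \<and>
      card {v \<in> W \<union> T. ?c v = a} \<le> b + 1" for a
  proof -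
    let ?S = "{v \<in> W. c v = a}"
    have S: "acyclic_graph (induced_subgraph G ?S)" "card ?S \<le> b"
      using c by (auto simp: forest_colouring_def)
    show ?thesis
    proof (cases "\<exists>x\<in>T. d x = a")
      case False
      then have "{v \<in> W \<union> T. ?c v = a} = ?S" by auto
      then show ?thesis using S by simp
    next
      case True
      then obtain x where x: "x \<in> T" "d x = a" by blast
      have eq: "{v \<in> W \<union> T. ?c v = a} = insert x ?S"
        using x T d(1) by (auto simp: inj_on_def split: if_splits)
      have "acyclic_graph (induced_subgraph G (insert x ?S))"
        by (rule acyclic_insert[OF S(1) sym]) (use d(2)[OF x(1)] x(2) in \<open>auto simp: available_def\<close>)
      moreover have "card (insert x ?S) \<le> b + 1"
        using S(2) fin by (simp add: card_insert_if)
      ultimately show ?thesis using eq by simp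
    qed
  qed
  ultimately show ?thesis unfolding forest_colouring_def by blast
qed

text \<open>When the \<open>j\<close>-th vertex of \<open>ys\<close> is coloured, \<open>j\<close> colours are taken inside the group, and fewer
  than \<open>k - j\<close> colours occur twice among its neighbours in \<open>W\<close>.\<close>

lemma extend_group:
  assumes c: "forest_colouring G L W b c"
    and sym: "\<And>u v. adj G u v \<Longrightarrow> adj G v u"
    and fin: "finite W" and ys: "distinct ys" "W \<inter> set ys = {}"
    and L: "\<And>y. y \<in> set ys \<Longrightarrow> finite (L y) \<and> card (L y) = k"
    and nb: "list_all2 (\<lambda>y xs. {w \<in> W. adj G y w} \<subseteq> set xs) ys nbs"
    and len: "\<And>j. j < length ys \<Longrightarrow> length (nbs ! j) < 2 * (k - j)"
  obtains c' where "forest_colouring G L (W \<union> set ys) (b + 1) c'" "\<And>v. v \<in> W \<Longrightarrow> c' v = c v"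
    "inj_on c' (set ys)"
proof -
  have "j < card (available G L W c (ys ! j))" if j: "j < length ys" for j
    by (rule card_available[where xs = "nbs ! j"])
      (use nb len[OF j] L[of "ys ! j"] j in \<open>auto simp: list_all2_conv_all_nth\<close>)
  then obtain d where d: "inj_on d (set ys)" "\<forall>y\<in>set ys. d y \<in> available G L W c y"
    using distinct_representatives[OF ys(1)] by blast
  let ?c = "\<lambda>v. if v \<in> W then c v else d v"
  have "inj_on ?c (set ys)" using d(1) ys(2) by (auto simp: inj_on_def)
  then show ?thesis
    using that[of ?c] extend_rainbow[OF c sym ys(2) d(1)] d(2) fin by simp
qed

lemma forest_colouring_empty: "forest_colouring G L {} 0 c"
  by (auto simp: forest_colouring_def acyclic_graph_def is_cycle_def induced_subgraph_def)

text \<open>By Hall's condition, three sets of size at least 2 lack distinct representatives only if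
  their union has just two elements.\<close>

lemma rainbow_triple_or_equal_pairs:
  assumes "2 \<le> card A" "2 \<le> card B" "2 \<le> card C"
  obtains (rainbow) a b c where "a \<in> A" "b \<in> B" "c \<in> C" "a \<noteq> b" "a \<noteq> c" "b \<noteq> c"
  | (pairs) p q where "p \<noteq> q" "A = {p, q}" "B = {p, q}" "C = {p, q}"
proof -
  have two: "\<exists>p q. p \<noteq> q \<and> p \<in> X \<and> q \<in> X" if X: "2 \<le> card X" for X :: "'a set"
  proof -
    obtain Y where "Y \<subseteq> X" "card Y = 2" using obtain_subset_with_card_n[OF X] by metis
    then show ?thesis by (auto simp: card_2_iff)
  qed
  obtain a1 a2 where a: "a1 \<noteq> a2" "a1 \<in> A" "a2 \<in> A" using two[OF assms(1)] by blast
  obtain b1 b2 where b: "b1 \<noteq> b2" "b1 \<in> B" "b2 \<in> B" using two[OF assms(2)] by blast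
  obtain c1 c2 where c: "c1 \<noteq> c2" "c1 \<in> C" "c2 \<in> C" using two[OF assms(3)] by blast
  show ?thesis
  proof (cases "\<exists>x\<in>A. \<exists>y\<in>B. \<exists>z\<in>C. x \<noteq> y \<and> x \<noteq> z \<and> y \<noteq> z")
    case True
    then show ?thesis using rainbow by blast
  next
    case False
    have B: "B = {a1, a2}"
    proof -
      \<comment> \<open>If \<open>x\<close> were outside, a colour of \<open>C\<close> other than
        \<open>x\<close> would still leave one of \<open>a1\<close>, \<open>a2\<close> free, giving
        a rainbow triple.\<close>
      have "x \<in> {a1, a2}" if "x \<in> B" for x using False a c that by (metis insert_iff)
      then show ?thesis using b by blast
    qed
    have "C = {a1, a2}"
    proof -
      have "x \<in> {a1, a2}" if "x \<in> C" for x using False a B that by (metis insert_iff)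
      then show ?thesis using c by blast
    qed
    moreover have "A = {a1, a2}"
    proof -
      have "x \<in> {a1, a2}" if "x \<in> A" for x
        using False a(1) B \<open>C = {a1, a2}\<close> that by (metis insert_iff)
      then show ?thesis using a by blast
    qed
    ultimately show ?thesis using pairs[OF a(1)] B by blast
  qed
qed

section \<open>The block graph: copies of the four-cycle in rows\<close>

text \<open>A vertex \<open>(t, s)\<close> is the \<open>s\<close>-th vertex of the \<open>t\<close>-th copy of the four-cycle
  \<open>P\<^sub>2 \<box> P\<^sub>2\<close>. The copies are numbered row by row, in rows of length \<open>m\<close>; the extra edges between
  the end of a row and the start of the next one do no harm.\<close>

definition cyc :: "nat \<Rightarrow> nat \<Rightarrow> bool" where
  "cyc s s' \<longleftrightarrow> (s, s') \<in> {(0,1), (1,2), (2,3), (3,0), (1,0), (2,1), (3,2), (0,3)}"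

definition block_graph :: "nat \<Rightarrow> (nat \<times> nat) graph" where
  "block_graph m = \<lparr>verts = UNIV, adj = (\<lambda>(t, s) (t', s').
     (t = t' \<and> cyc s s') \<or> (s = s' \<and> (t' = t + 1 \<or> t = t' + 1 \<or> t' = t + m \<or> t = t' + m)))\<rparr>"

abbreviation blocks :: "nat \<Rightarrow> (nat \<times> nat) set" where
  "blocks n \<equiv> {..<n} \<times> {..<4}"

lemma block_adj_sym: "adj (block_graph m) x y \<Longrightarrow> adj (block_graph m) y x"
  by (auto simp: block_graph_def cyc_def split: prod.splits)

lemma block_adj:
  "adj (block_graph m) (t, s) (t', s') \<longleftrightarrow>
     (t = t' \<and> cyc s s') \<or> (s = s' \<and> (t' = t + 1 \<or> t = t' + 1 \<or> t' = t + m \<or> t = t' + m))"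
  by (simp add: block_graph_def)


text \<open>The rotations of the cyclic labelling: any edge of the four-cycle can play the role of
  \<open>z\<close>, \<open>u\<close>.\<close>

definition square :: "nat \<Rightarrow> nat \<Rightarrow> nat \<Rightarrow> nat \<Rightarrow> bool" where
  "square z u v w \<longleftrightarrow> (z, u, v, w) \<in> {(0,1,2,3), (1,2,3,0), (2,3,0,1), (3,0,1,2)}"

lemma square_facts:
  assumes "square z u v w"
  shows "{..<4} = {z, u, v, w}"
    "z \<noteq> u" "z \<noteq> v" "z \<noteq> w" "u \<noteq> v" "u \<noteq> w" "v \<noteq> w"
    "u \<noteq> z" "v \<noteq> z" "w \<noteq> z" "v \<noteq> u" "w \<noteq> u" "w \<noteq> v"
    "cyc z s \<longleftrightarrow> s = u \<or> s = w" "cyc u s \<longleftrightarrow> s = z \<or> s = v"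
    "cyc v s \<longleftrightarrow> s = u \<or> s = w" "cyc w s \<longleftrightarrow> s = z \<or> s = v"
  using assms by (auto simp: square_def cyc_def)

text \<open>If all edges of copy \<open>t\<close> were monochromatic, the copy would be a cycle in a
  single colour class.\<close>

lemma square_edge_differs:
  assumes c: "forest_colouring (block_graph m) L (blocks n) b c" and t: "t < n"
  obtains z u v w where "square z u v w" "c (t, z) \<noteq> c (t, u)"
proof (rule ccontr)
  note prem = that
  assume "\<not> thesis"
  then have eq: "c (t, z) = c (t, u)" if sq: "square z u v w" for z u v w
    using prem[OF sq] by blast
  have e: "c (t, 0) = c (t, 1)" "c (t, 1) = c (t, 2)" "c (t, 2) = c (t, 3)"
    by (rule eq, simp add: square_def)+
  let ?S = "{v \<in> blocks n. c v = c (t, 0)}"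
  have "is_cycle (induced_subgraph (block_graph m) ?S) [(t, 0), (t, 1), (t, 2), (t, 3)]"
    using e t by (auto simp: is_cycle_def induced_subgraph_def block_graph_def cyc_def less_Suc_eq)
  then show False using c by (auto simp: forest_colouring_def acyclic_graph_def)
qed

lemma card_colour_le_1:
  assumes "inj_on c T"
  shows "card {v \<in> T. c v = a} \<le> 1"
proof (cases "\<exists>x\<in>T. c x = a")
  case True
  then obtain x where "x \<in> T" "c x = a" by blast
  then have "{v \<in> T. c v = a} = {x}" using assms by (auto simp: inj_on_def)
  then show ?thesis by simp
next
  case False
  then have "{v \<in> T. c v = a} = {}" by auto
  then show ?thesis by (metis card.empty zero_le)
qed

text \<open>A colour absent from one of three rainbow groups gains at most 2 instead of 3. The place
  saved allows it to be used twice among the last three vertices.\<close>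

lemma card_colour_missing:
  assumes W: "card {v \<in> W. c v = a} \<le> b" and inj: "inj_on c T1" "inj_on c T2"
    and T3: "a \<notin> c ` T3"
  shows "card {v \<in> W \<union> T1 \<union> T2 \<union> T3. c v = a} \<le> b + 2"
proof -
  have eq: "{v \<in> W \<union> T1 \<union> T2 \<union> T3. c v = a} =
      {v \<in> W. c v = a} \<union> {v \<in> T1. c v = a} \<union> {v \<in> T2. c v = a}"
    using T3 by auto
  show ?thesis unfolding eq
    using W card_colour_le_1[OF inj(1), of a] card_colour_le_1[OF inj(2), of a]
      card_Un_le[of "{v \<in> W. c v = a} \<union> {v \<in> T1. c v = a}" "{v \<in> T2. c v = a}"]
      card_Un_le[of "{v \<in> W. c v = a}" "{v \<in> T1. c v = a}"] by linarith
qed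

section \<open>Adding two copies with four colours, or three copies with three colours\<close>

text \<open>In a group of four the numbers of earlier neighbours must stay below 8, 6, 4, 2 in this
  order. Each group ends in a vertex of copy \<open>n + 1\<close> whose neighbours in copies
  \<open>n\<close> and \<open>n + 1\<close> belong to the same group or are still
  uncoloured.\<close>

lemma blocks_extend_2:
  assumes c: "forest_colouring (block_graph m) L (blocks n) b c" and m: "m \<ge> 1"
    and L: "\<And>v. v \<in> blocks (n + 2) \<Longrightarrow> finite (L v) \<and> card (L v) = 4"
  shows "\<exists>c'. forest_colouring (block_graph m) L (blocks (n + 2)) (b + 2) c'"
proof -
  let ?G = "block_graph m"
  define ys1 where "ys1 = [(n, 1::nat), (n, 3), (n, 2), (n + 1, 2)]"
  define ys2 where "ys2 = [(n, 0::nat), (n + 1, 1), (n + 1, 3), (n + 1, 0)]"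
  \<comment> \<open>The lists in \<open>nbs\<close> only have to contain the earlier neighbours, so
    entries produced by truncated subtraction do no harm.\<close>
  obtain c1 where c1: "forest_colouring ?G L (blocks n \<union> set ys1) (b + 1) c1"
    by (rule extend_group[OF c block_adj_sym, where ys = ys1 and k = 4 and nbs =
          "[[(n - 1, 1), (n - m, 1)], [(n - 1, 3), (n - m, 3)], [(n - 1, 2), (n - m, 2)],
            [(n + 1 - m, 2)]]"])
      (use m L in \<open>auto simp: ys1_def block_adj cyc_def less_Suc_eq\<close>)
  obtain c2 where "forest_colouring ?G L (blocks n \<union> set ys1 \<union> set ys2) (b + 1 + 1) c2"
    by (rule extend_group[OF c1 block_adj_sym, where ys = ys2 and k = 4 and nbs =
          "[[(n - 1, 0), (n - m, 0), (n, 1), (n, 3)], [(n, 1), (n + 1 - m, 1), (n + 1, 2)],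
            [(n, 3), (n + 1 - m, 3), (n + 1, 2)], [(n + 1 - m, 0)]]"])
      (use m L in \<open>auto simp: ys1_def ys2_def block_adj cyc_def less_Suc_eq\<close>)
  moreover have "blocks n \<union> set ys1 \<union> set ys2 = blocks (n + 2)"
    by (auto simp: ys1_def ys2_def less_Suc_eq numeral_eq_Suc)
  moreover have "b + 1 + 1 = b + 2" by simp
  ultimately show ?thesis by metis
qed

text \<open>Twelve vertices allow each class four more: one for each greedy triple and one for the
  remaining path.\<close>

lemma blocks_extend_3:
  assumes c: "forest_colouring (block_graph m) L (blocks n) b c" and m: "m \<ge> 1"
    and L: "\<And>v. v \<in> blocks (n + 3) \<Longrightarrow> finite (L v) \<and> card (L v) = 3"
  shows "\<exists>c'. forest_colouring (block_graph m) L (blocks (n + 3)) (b + 4) c'"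
proof -
  let ?G = "block_graph m"
  (* The labelling is rotated so that the neighbours of z and u in the previous row differ in
     colour; otherwise z might not become a leaf when it shares its colour with u. *)
  obtain z u v w where sq: "square z u v w"
    and up: "m \<ge> 3 \<Longrightarrow> m \<le> n + 2 \<Longrightarrow> c (n + 2 - m, z) \<noteq> c (n + 2 - m, u)"
  proof (cases "m \<ge> 3 \<and> m \<le> n + 2")
    case True
    then have "n + 2 - m < n" by auto
    then show ?thesis using square_edge_differs[OF c] that by metis
  next
    case False
    then show ?thesis using that[of 0 1 2 3] by (auto simp: square_def)
  qed
  note sqf = square_facts[OF sq]
  \<comment> \<open>The thresholds for a triple are 6, 4, 2. Outside its triple, the last vertex has
    at most one coloured neighbour, the one \<open>m\<close> copies back.\<close>
  define ys1 where "ys1 = [(n, v), (n, w), (n + 1, w)]"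
  define ys2 where "ys2 = [(n, u), (n + 1, v), (n + 1, u)]"
  define ys3 where "ys3 = [(n, z), (n + 1, z), (n + 2, z)]"
  note ys = ys1_def ys2_def ys3_def
  obtain c1 where c1: "forest_colouring ?G L (blocks n \<union> set ys1) (b + 1) c1"
    and e1: "\<And>x. x \<in> blocks n \<Longrightarrow> c1 x = c x" and i1: "inj_on c1 (set ys1)"
    by (rule extend_group[OF c block_adj_sym, where ys = ys1 and k = 3 and nbs =
          "[[(n - 1, v), (n - m, v)], [(n - 1, w), (n - m, w)], [(n + 1 - m, w)]]"])
      (use m L in \<open>auto simp: ys block_adj sqf less_Suc_eq\<close>)
  obtain c2 where c2: "forest_colouring ?G L (blocks n \<union> set ys1 \<union> set ys2) (b + 1 + 1) c2"
    and e2: "\<And>x. x \<in> blocks n \<union> set ys1 \<Longrightarrow> c2 x = c1 x" and i2: "inj_on c2 (set ys2)"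
    by (rule extend_group[OF c1 block_adj_sym, where ys = ys2 and k = 3 and nbs =
          "[[(n - 1, u), (n - m, u), (n, v)], [(n, v), (n + 1 - m, v), (n + 1, w)],
            [(n + 1 - m, u)]]"])
      (use m L in \<open>auto simp: ys block_adj sqf less_Suc_eq\<close>)
  define W where "W = blocks n \<union> set ys1 \<union> set ys2 \<union> set ys3"
  obtain d where d: "forest_colouring ?G L W (b + 1 + 1 + 1) d"
    and e3: "\<And>x. x \<in> blocks n \<union> set ys1 \<union> set ys2 \<Longrightarrow> d x = c2 x" and i3: "inj_on d (set ys3)"
    unfolding W_def
    by (rule extend_group[OF c2 block_adj_sym, where ys = ys3 and k = 3 and nbs =
          "[[(n - 1, z), (n - m, z), (n, u), (n, w)], [(n + 1 - m, z), (n + 1, u), (n + 1, w)],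
            [(n + 2 - m, z)]]"])
      (use m L in \<open>auto simp: ys block_adj sqf less_Suc_eq\<close>)
  have dc: "d x = c x" if "x \<in> blocks n" for x using that e1 e2 e3 by auto
  have j1: "inj_on d (set ys1)" using i1 e2 e3 by (auto simp: inj_on_def)
  have j2: "inj_on d (set ys2)" using i2 e3 by (auto simp: inj_on_def)
  have finW: "finite W" by (simp add: W_def)
  \<comment> \<open>\<open>U\<close>, \<open>V\<close>, \<open>X\<close> form the remaining path;
    \<open>Z\<close>, coloured already, closes the four-cycle.\<close>
  define U V X Z where "U = (n + 2, u)" and "V = (n + 2, v)" and "X = (n + 2, w)"
    and "Z = (n + 2, z)"
  note UVXZ = U_def V_def X_def Z_def
  have all: "blocks (n + 3) = W \<union> {U, V, X}"
  proof -
    have "{..<n + 3} = {..<n} \<union> {n, n + 1, n + 2}" by auto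
    then have "blocks (n + 3) = blocks n \<union> {n, n + 1, n + 2} \<times> {z, u, v, w}"
      unfolding sqf(1) by blast
    also have "{n, n + 1, n + 2} \<times> {z, u, v, w} =
        {(n, v), (n, w), (n + 1, w)} \<union> {(n, u), (n + 1, v), (n + 1, u)} \<union>
        {(n, z), (n + 1, z), (n + 2, z)} \<union> {U, V, X}"
      unfolding UVXZ insert_Times_insert by (simp add: insert_commute)
    finally show ?thesis unfolding W_def ys list.set by (simp only: Un_assoc)
  qed
  have new: "U \<notin> W" "V \<notin> W" "X \<notin> W" "U \<noteq> V" "U \<noteq> X" "V \<noteq> X" "Z \<in> W" "Z \<noteq> U"
    by (auto simp: W_def ys UVXZ sqf)
  have LU: "finite (L x) \<and> card (L x) = 3" if "x \<in> {U, V, X}" for x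
    by (rule L) (use that all in auto)
  have nU: "{x \<in> W. adj ?G U x} \<subseteq> set [Z, (n + 1, u), (n + 2 - m, u)]"
    using m by (auto simp: W_def ys UVXZ block_adj sqf)
  have nV: "{x \<in> W. adj ?G V x} \<subseteq> set [(n + 1, v), (n + 2 - m, v)]"
    using m by (auto simp: W_def ys UVXZ block_adj sqf)
  have nX: "{x \<in> W. adj ?G X x} \<subseteq> set [Z, (n + 1, w), (n + 2 - m, w)]"
    using m by (auto simp: W_def ys UVXZ block_adj sqf)
  have nZ: "{x \<in> W. adj ?G Z x} \<subseteq> {(n + 1, z), (n + 2 - m, z)}"
    using m by (auto simp: W_def ys UVXZ block_adj sqf)
  have nadj: "\<not> adj ?G X U" "\<not> adj ?G U X" using m by (auto simp: UVXZ block_adj sqf)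
  let ?A = "available ?G L W d"
  have two: "2 \<le> card (?A y)" if "1 < card (?A y)" for y using that by linarith
  \<comment> \<open>With at most three coloured neighbours, only one colour can be repeated, which
    leaves two of the three list colours.\<close>
  have "2 \<le> card (?A U)" by (rule two, rule card_available[OF nU, where k = 3]) (simp_all add: LU)
  moreover have "2 \<le> card (?A V)"
    by (rule two, rule card_available[OF nV, where k = 3]) (simp_all add: LU)
  moreover have "2 \<le> card (?A X)"
    by (rule two, rule card_available[OF nX, where k = 3]) (simp_all add: LU)
  ultimately show ?thesis
  proof (cases rule: rainbow_triple_or_equal_pairs)
    case (rainbow a1 a2 a3)
    let ?d = "\<lambda>x. if x = U then a1 else if x = V then a2 else a3"
    have "forest_colouring ?G L (W \<union> {U, V, X}) (b + 1 + 1 + 1 + 1)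
        (\<lambda>x. if x \<in> W then d x else ?d x)"
      by (rule extend_rainbow[OF d block_adj_sym])
        (use rainbow new finW in \<open>auto simp: inj_on_def\<close>)
    moreover have "b + 1 + 1 + 1 + 1 = b + 4" by simp
    ultimately show ?thesis unfolding all by metis
  next
    case (pairs p q)
    have S: "acyclic_graph (induced_subgraph ?G {x \<in> W. d x = a})" "card {x \<in> W. d x = a} \<le> b + 3"
      and dL: "\<And>x. x \<in> W \<Longrightarrow> d x \<in> L x" for a
      using d by (auto simp: forest_colouring_def numeral_eq_Suc)
    have S4: "card {x \<in> W. d x = a} \<le> b + 4" for a using S(2)[of a] by linarith
    have av: "a \<in> L y" "\<And>x x'. x \<in> W \<Longrightarrow> x' \<in> W \<Longrightarrow> adj ?G y x \<Longrightarrow> adj ?G y x' \<Longrightarrow>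
        d x = a \<Longrightarrow> d x' = a \<Longrightarrow> x = x'"
      if "a = p \<or> a = q" "y = U \<or> y = V \<or> y = X" for a y
    proof -
      have "a \<in> ?A y" using that pairs by auto
      then show "a \<in> L y" "\<And>x x'. x \<in> W \<Longrightarrow> x' \<in> W \<Longrightarrow> adj ?G y x \<Longrightarrow> adj ?G y x' \<Longrightarrow>
        d x = a \<Longrightarrow> d x' = a \<Longrightarrow> x = x'" by (auto simp: available_def)
    qed
    have cW: "card {x \<in> blocks n. d x = a} \<le> b" for a
    proof -
      have "{x \<in> blocks n. d x = a} = {x \<in> blocks n. c x = a}" using dc by auto
      then show ?thesis using c by (simp add: forest_colouring_def)
    qed
    have one: "acyclic_graph (induced_subgraph ?G (insert y {x \<in> W. d x = a}))"
        "card (insert y {x \<in> W. d x = a}) \<le> b + 4"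
      if "a = p \<or> a = q" "y = U \<or> y = V \<or> y = X" for a y
    proof -
      show "acyclic_graph (induced_subgraph ?G (insert y {x \<in> W. d x = a}))"
        by (rule acyclic_insert[OF S(1) block_adj_sym]) (use av(2)[OF that] in auto)
      show "card (insert y {x \<in> W. d x = a}) \<le> b + 4"
        using S(2)[of a] finW by (simp add: card_insert_if)
    qed
    show ?thesis
    proof (cases "\<exists>a\<in>{p, q}. a \<notin> d ` set ys1 \<or> a \<notin> d ` set ys2 \<or> a \<notin> d ` set ys3")
      case True
      then obtain a where a: "a = p \<or> a = q"
        "a \<notin> d ` set ys1 \<or> a \<notin> d ` set ys2 \<or> a \<notin> d ` set ys3" by blast
      \<comment> \<open>The class of \<open>a\<close> has a spare place, so \<open>a\<close> goes to
        both \<open>U\<close> and \<open>X\<close>, which are not adjacent, and \<open>V\<close>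
        takes the other colour.\<close>
      define a' where "a' = (if a = p then q else p)"
      have ne: "a \<noteq> a'" and pq: "a = p \<or> a = q" "a' = p \<or> a' = q"
        using pairs(1) a(1) by (auto simp: a'_def)
      have W': "W = blocks n \<union> set ys1 \<union> set ys3 \<union> set ys2"
        "W = blocks n \<union> set ys2 \<union> set ys3 \<union> set ys1"
        unfolding W_def by (simp_all only: Un_ac)
      have le: "card {x \<in> W. d x = a} \<le> b + 2"
        using a(2) card_colour_missing[OF cW j1 j2, of a "set ys3", folded W_def]
          card_colour_missing[OF cW j1 i3, of a "set ys2", folded W'(1)]
          card_colour_missing[OF cW j2 i3, of a "set ys1", folded W'(2)] by blast
      let ?e = "\<lambda>x. if x \<in> W then d x else if x = V then a' else a"
      have cls: "{x \<in> W \<union> {U, V, X}. ?e x = f} =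
         (if f = a then insert X (insert U {x \<in> W. d x = a})
          else if f = a' then insert V {x \<in> W. d x = a'} else {x \<in> W. d x = f})" for f
        using new ne by (auto split: if_splits)
      have "acyclic_graph (induced_subgraph ?G (insert X (insert U {x \<in> W. d x = a})))"
      proof (rule acyclic_insert[OF one(1)[OF pq(1)] block_adj_sym])
        show "x = y" if "x \<in> insert U {x \<in> W. d x = a}" "y \<in> insert U {x \<in> W. d x = a}"
          "adj ?G X x" "adj ?G X y" for x y
        proof -
          have "x \<noteq> U" "y \<noteq> U" using that(3,4) nadj by metis+
          then show ?thesis using that av(2)[OF pq(1), of X x y] by simp
        qed
      qed simp
      moreover have "card (insert X (insert U {x \<in> W. d x = a})) \<le> b + 4"
        using le finW by (simp add: card_insert_if)
      moreover have "?e x \<in> L x" if "x \<in> W \<union> {U, V, X}" for x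
        using that dL[of x] new av(1)[OF pq(1), of U] av(1)[OF pq(1), of X]
          av(1)[OF pq(2), of V] by auto
      ultimately have "forest_colouring ?G L (W \<union> {U, V, X}) (b + 4) ?e"
        unfolding forest_colouring_def cls using one[OF pq(2), of V] S(1) S4 by simp
      then show ?thesis unfolding all by blast
    next
      case False
      then have inG: "p \<in> d ` set ys2" "q \<in> d ` set ys2" "p \<in> d ` set ys3" "q \<in> d ` set ys3" by auto
      \<comment> \<open>Only \<open>p\<close> and \<open>q\<close> are available, so a third colour
        of the list is blocked by two neighbours.\<close>
      have repeated: "\<exists>r x x'. r \<in> L y \<and> r \<noteq> p \<and> r \<noteq> q \<and> x \<in> W \<and> x' \<in> W \<and> x \<noteq> x' \<and>
          adj ?G y x \<and> adj ?G y x' \<and> d x = r \<and> d x' = r"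
        if "y = U \<or> y = V" for y
      proof -
        have "\<not> L y \<subseteq> {p, q}"
          using LU[of y] that card_mono[of "{p, q}" "L y"] pairs(1) by auto
        then obtain r where r: "r \<in> L y" "r \<noteq> p" "r \<noteq> q" by auto
        moreover have "r \<notin> ?A y" using r that pairs by auto
        ultimately show ?thesis unfolding available_def by blast
      qed
      \<comment> \<open>\<open>V\<close> has at most two coloured neighbours, so both carry its
        blocked colour.\<close>
      have dv: "d (n + 1, v) \<noteq> p" "d (n + 1, v) \<noteq> q"
      proof -
        obtain r x x' where "r \<noteq> p" "r \<noteq> q" "x \<in> W" "x' \<in> W" "x \<noteq> x'"
          "adj ?G V x" "adj ?G V x'" "d x = r" "d x' = r" using repeated[of V] by blast
        moreover from this have "x \<in> {(n + 1, v), (n + 2 - m, v)}" "x' \<in> {(n + 1, v), (n + 2 - m, v)}"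
          using nV by auto
        ultimately show "d (n + 1, v) \<noteq> p" "d (n + 1, v) \<noteq> q" by auto
      qed
      \<comment> \<open>The second triple contains \<open>p\<close> and \<open>q\<close>, and
        \<open>(n + 1, v)\<close> carries neither.\<close>
      have du: "{d (n, u), d (n + 1, u)} = {p, q}"
      proof -
        have "p = d (n, u) \<or> p = d (n + 1, v) \<or> p = d (n + 1, u)"
          "q = d (n, u) \<or> q = d (n + 1, v) \<or> q = d (n + 1, u)"
          using inG(1,2) by (simp_all add: ys)
        then show ?thesis using dv pairs(1) by blast
      qed
      \<comment> \<open>Since \<open>(n + 1, u)\<close> carries \<open>p\<close> or
        \<open>q\<close>, the blocked colour of \<open>U\<close> sits on its two other coloured
        neighbours.\<close>
      obtain r where r: "r \<in> L U" "r \<noteq> p" "r \<noteq> q" "d Z = r" "d (n + 2 - m, u) = r"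
        "adj ?G U (n + 2 - m, u)"
      proof -
        obtain r x x' where r: "r \<in> L U" "r \<noteq> p" "r \<noteq> q" "x \<in> W" "x' \<in> W" "x \<noteq> x'"
          "adj ?G U x" "adj ?G U x'" "d x = r" "d x' = r" using repeated[of U] by blast
        then have "x \<in> {Z, (n + 1, u), (n + 2 - m, u)}" "x' \<in> {Z, (n + 1, u), (n + 2 - m, u)}"
          using nU by auto
        moreover have "x \<noteq> (n + 1, u)" "x' \<noteq> (n + 1, u)" using r(2,3,9,10) du by blast+
        ultimately have "x = Z \<and> x' = (n + 2 - m, u) \<or> x' = Z \<and> x = (n + 2 - m, u)"
          using r(6) by blast
        then show ?thesis using that[of r] r by metis
      qed
      \<comment> \<open>The same argument in the third triple, where \<open>Z\<close> carries
        \<open>r\<close>.\<close>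
      have dz: "{d (n, z), d (n + 1, z)} = {p, q}"
      proof -
        have "p = d (n, z) \<or> p = d (n + 1, z) \<or> p = d Z" "q = d (n, z) \<or> q = d (n + 1, z) \<or> q = d Z"
          using inG(3,4) by (simp_all add: ys Z_def)
        then show ?thesis using r(2-4) pairs(1) by blast
      qed
      have m3: "m \<ge> 3"
      proof (rule ccontr)
        assume "\<not> m \<ge> 3"
        then have "m = 1 \<or> m = 2" using m by auto
        then have "r \<in> {d (n, u), d (n + 1, u)}" using r(5) by auto
        then show False using r(2,3) unfolding du by blast
      qed
      \<comment> \<open>For \<open>m > n + 2\<close> the truncated difference would be 0, and copy 0
        is then not joined to copy \<open>n + 2\<close>.\<close>
      have mn: "m \<le> n + 2" using r(6) by (auto simp: U_def block_adj)
      have "d (n + 2 - m, s) = c (n + 2 - m, s)" if "s \<in> {z, u, v, w}" for s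
        by (rule dc) (unfold sqf(1), use that m3 mn in simp)
      then have "d (n + 2 - m, z) \<noteq> d (n + 2 - m, u)"
        using up[OF m3 mn] by simp
      then have dfz: "d (n + 2 - m, z) \<noteq> r" using r(5) by simp
      let ?e = "\<lambda>x. if x \<in> W then d x else if x = U then r else if x = V then p else q"
      \<comment> \<open>\<open>Z\<close> is removed and inserted again last: \<open>U\<close> meets
        \<open>?S\<close> at most in \<open>(n + 2 - m, u)\<close>, and afterwards \<open>Z\<close>
        has no neighbour in the class but \<open>U\<close>.\<close>
      let ?S = "{x \<in> W. d x = r} - {Z}"
      have cls: "{x \<in> W \<union> {U, V, X}. ?e x = f} =
         (if f = r then insert Z (insert U ?S) else if f = p then insert V {x \<in> W. d x = p}
          else if f = q then insert X {x \<in> W. d x = q} else {x \<in> W. d x = f})" for f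
        using new r(2-4) pairs(1) by (auto split: if_splits)
      have acU: "acyclic_graph (induced_subgraph ?G (insert U ?S))"
      proof (rule acyclic_insert[OF acyclic_induced_subset[OF S(1)[of r]] block_adj_sym])
        have *: "x = (n + 2 - m, u)" if "x \<in> ?S" "adj ?G U x" for x
          using that nU du r(2,3) by auto
        show "x = y" if "x \<in> ?S" "y \<in> ?S" "adj ?G U x" "adj ?G U y" for x y
          using *[of x] *[of y] that by simp
      qed auto
      have "acyclic_graph (induced_subgraph ?G (insert Z (insert U ?S)))"
      proof (rule acyclic_insert[OF acU block_adj_sym])
        have *: "x = U" if "x \<in> insert U ?S" "adj ?G Z x" for x
          using that nZ dz dfz r(2,3) by auto
        show "x = y" if "x \<in> insert U ?S" "y \<in> insert U ?S" "adj ?G Z x" "adj ?G Z y" for x y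
          using *[of x] *[of y] that by simp
      qed
      moreover have "card (insert Z (insert U ?S)) \<le> b + 4"
      proof -
        have "insert Z (insert U ?S) = insert U {x \<in> W. d x = r}" using new r(4) by auto
        then show ?thesis using S(2)[of r] finW by (simp add: card_insert_if)
      qed
      moreover have "?e x \<in> L x" if "x \<in> W \<union> {U, V, X}" for x
        using that dL[of x] new av(1)[of p V] av(1)[of q X] r(1) by auto
      ultimately have "forest_colouring ?G L (W \<union> {U, V, X}) (b + 4) ?e"
        unfolding forest_colouring_def cls using one[of p V] one[of q X] S(1) S4 by simp
      then show ?thesis unfolding all by blast
    qed
  qed
qed

section \<open>Colouring any number of copies with lists of size 4 or 3\<close>

text \<open>Two copies are added at a time; a single initial copy is one rainbow group.\<close>

lemma blocks_colouring_4:
  assumes m: "m \<ge> 1" and L: "\<And>v. v \<in> blocks n \<Longrightarrow> finite (L v) \<and> card (L v) = 4"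
  shows "\<exists>c. forest_colouring (block_graph m) L (blocks n) n c"
  using L
proof (induction n rule: induct_nat_012)
  case 0
  show ?case using forest_colouring_empty[of "block_graph m" L] by auto
next
  case 1
  let ?ys = "[(0, 0), (0, 1), (0, 2), (0, 3)] :: (nat \<times> nat) list"
  obtain c where "forest_colouring (block_graph m) L ({} \<union> set ?ys) (0 + 1) c"
    by (rule extend_group[OF forest_colouring_empty[of "block_graph m" L "\<lambda>_. undefined"] block_adj_sym,
          where ys = ?ys and k = 4 and nbs = "[[], [], [], []]"])
      (use 1 in \<open>auto simp: less_Suc_eq\<close>)
  moreover have "{} \<union> set ?ys = blocks 1" by (auto simp: less_Suc_eq numeral_eq_Suc)
  ultimately show ?case by auto
next
  case (ge2 n)
  have "\<exists>c. forest_colouring (block_graph m) L (blocks n) n c"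
    by (rule ge2.IH(1)) (use ge2.prems in auto)
  then obtain c where "forest_colouring (block_graph m) L (blocks n) n c" ..
  from blocks_extend_2[OF this m] show ?case using ge2.prems by simp
qed

text \<open>The bound is the ceiling of \<open>4 * n / 3\<close>, which grows by 4 with three
  copies. One or two initial copies split greedily into groups of sizes 3, 1 or 3, 3, 2.\<close>

lemma blocks_colouring_3:
  assumes m: "m \<ge> 1" and L: "\<And>v. v \<in> blocks n \<Longrightarrow> finite (L v) \<and> card (L v) = 3"
  shows "\<exists>c. forest_colouring (block_graph m) L (blocks n) ((4 * n + 2) div 3) c"
  using L
proof (induction n rule: less_induct)
  case (less n)
  let ?G = "block_graph m"
  consider "n = 0" | "n = 1" | "n = 2" | "n \<ge> 3" by linarith
  then show ?case
  proof cases
    case 1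
    then show ?thesis using forest_colouring_empty[of ?G L] by auto
  next
    case 2
    let ?ys1 = "[(0, 0), (0, 1), (0, 2)] :: (nat \<times> nat) list"
    let ?ys2 = "[(0, 3)] :: (nat \<times> nat) list"
    obtain c1 where c1: "forest_colouring ?G L ({} \<union> set ?ys1) (0 + 1) c1"
      by (rule extend_group[OF forest_colouring_empty[of "block_graph m" L "\<lambda>_. undefined"] block_adj_sym,
            where ys = ?ys1 and k = 3 and nbs = "[[], [], []]"])
        (use less.prems 2 in \<open>auto simp: less_Suc_eq\<close>)
    obtain c2 where "forest_colouring ?G L ({} \<union> set ?ys1 \<union> set ?ys2) (0 + 1 + 1) c2"
      by (rule extend_group[OF c1 block_adj_sym,
            where ys = ?ys2 and k = 3 and nbs = "[[(0, 0), (0, 2)]]"])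
        (use less.prems 2 m in \<open>auto simp: block_adj cyc_def\<close>)
    moreover have "{} \<union> set ?ys1 \<union> set ?ys2 = blocks n"
      using 2 by (auto simp: less_Suc_eq numeral_eq_Suc)
    moreover have "0 + 1 + 1 = (4 * n + 2) div 3" using 2 by simp
    ultimately show ?thesis by metis
  next
    case 3
    let ?ys1 = "[(0, 0), (0, 1), (0, 2)] :: (nat \<times> nat) list"
    let ?ys2 = "[(0, 3), (1, 0), (1, 3)] :: (nat \<times> nat) list"
    let ?ys3 = "[(1, 1), (1, 2)] :: (nat \<times> nat) list"
    obtain c1 where c1: "forest_colouring ?G L ({} \<union> set ?ys1) (0 + 1) c1"
      by (rule extend_group[OF forest_colouring_empty[of "block_graph m" L "\<lambda>_. undefined"] block_adj_sym,
            where ys = ?ys1 and k = 3 and nbs = "[[], [], []]"])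
        (use less.prems 3 in \<open>auto simp: less_Suc_eq\<close>)
    obtain c2 where c2: "forest_colouring ?G L ({} \<union> set ?ys1 \<union> set ?ys2) (0 + 1 + 1) c2"
      by (rule extend_group[OF c1 block_adj_sym,
            where ys = ?ys2 and k = 3 and nbs = "[[(0, 0), (0, 2)], [(0, 0)], []]"])
        (use less.prems 3 m in \<open>auto simp: block_adj cyc_def less_Suc_eq\<close>)
    obtain c3 where "forest_colouring ?G L ({} \<union> set ?ys1 \<union> set ?ys2 \<union> set ?ys3) (0 + 1 + 1 + 1) c3"
      by (rule extend_group[OF c2 block_adj_sym,
            where ys = ?ys3 and k = 3 and nbs = "[[(0, 1), (1, 0)], [(0, 2), (1, 3)]]"])
        (use less.prems 3 m in \<open>auto simp: block_adj cyc_def less_Suc_eq\<close>)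
    moreover have "{} \<union> set ?ys1 \<union> set ?ys2 \<union> set ?ys3 = blocks n"
      using 3 by (auto simp: less_Suc_eq numeral_eq_Suc)
    moreover have "0 + 1 + 1 + 1 = (4 * n + 2) div 3" using 3 by simp
    ultimately show ?thesis by metis
  next
    case 4
    define n' where "n' = n - 3"
    have n: "n = n' + 3" using 4 by (simp add: n'_def)
    have "\<exists>c. forest_colouring ?G L (blocks n') ((4 * n' + 2) div 3) c"
      by (rule less.IH) (use n less.prems in auto)
    then obtain c where "forest_colouring ?G L (blocks n') ((4 * n' + 2) div 3) c" ..
    from blocks_extend_3[OF this m]
    have "\<exists>c. forest_colouring ?G L (blocks n) ((4 * n' + 2) div 3 + 4) c"
      using less.prems n by simp
    moreover have "(4 * n' + 2) div 3 + 4 = (4 * n + 2) div 3" using n by simp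
    ultimately show ?thesis by simp
  qed
qed

section \<open>Lists of size at least 5, and the common bound\<close>

text \<open>Removing the last \<open>k\<close> vertices in the order \<open>4 * t + s\<close> may
  cut through a copy, so the induction runs over all initial segments.\<close>

lemma window_colouring:
  assumes m: "m \<ge> 1" and k: "k \<ge> 5"
    and L: "\<And>i. i < n \<Longrightarrow> finite (L (i div 4, i mod 4)) \<and> card (L (i div 4, i mod 4)) = k"
  shows "\<exists>c. forest_colouring (block_graph m) L ((\<lambda>i. (i div 4, i mod 4)) ` {..<n}) ((n + k - 1) div k) c"
  using L
proof (induction n rule: less_induct)
  case (less n)
  let ?G = "block_graph m"
  let ?f = "\<lambda>i::nat. (i div 4, i mod 4)"
  have inj: "?f i = ?f j \<longleftrightarrow> i = j" for i j by (metis div_mult_mod_eq prod.inject)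
  have injon: "inj_on ?f A" for A using inj by (auto simp: inj_on_def)
  consider "n = 0" | "0 < n" "n < k" | "n \<ge> k" by linarith
  then show ?case
  proof cases
    case 1
    then have "(n + k - 1) div k = 0" using k by simp
    then show ?thesis using 1 forest_colouring_empty[of ?G L] by auto
  next
    case 2
    obtain c where "forest_colouring ?G L ({} \<union> set (map ?f [0..<n])) (0 + 1) c"
      by (rule extend_group[OF forest_colouring_empty[of "block_graph m" L "\<lambda>_. undefined"] block_adj_sym,
            where ys = "map ?f [0..<n]" and k = k and nbs = "replicate n []"])
        (use less.prems 2 in \<open>auto simp: distinct_map injon list_all2_conv_all_nth\<close>)
    moreover have "{} \<union> set (map ?f [0..<n]) = ?f ` {..<n}" by (simp add: atLeast0LessThan)
    moreover have "0 + 1 = (n + k - 1) div k"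
    proof -
      have "n + k - 1 = n - 1 + k" using 2 by simp
      then show ?thesis using 2 div_add_self2[of k "n - 1"] by simp
    qed
    ultimately show ?thesis by metis
  next
    case 3
    define r where "r = n - k"
    have n: "n = r + k" using 3 by (simp add: r_def)
    let ?W = "?f ` {..<r}"
    have "\<exists>c. forest_colouring ?G L ?W ((r + k - 1) div k) c"
      by (rule less.IH) (use n k less.prems in auto)
    then obtain c where c: "forest_colouring ?G L ?W ((r + k - 1) div k) c" ..
    \<comment> \<open>Earlier cycle neighbours lie at most 3 indices back and the previous copy 4
      back. As \<open>k \<ge> 5\<close>, they fall inside the window for its last two vertices and
      its last vertex respectively, leaving at most 4, ..., 4, 2, 1 neighbours before the
      window.\<close>
    define nb where "nb i = [(i div 4 - m, i mod 4)] @
        (if i < r + (k - 1) then [(i div 4 - 1, i mod 4)] else []) @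
        (if i < r + (k - 2) then [(i div 4, (i + 1) mod 4), (i div 4, (i + 3) mod 4)] else [])" for i
    have W: "{w \<in> ?W. adj ?G (?f i) w} \<subseteq> set (nb i)" if i: "r \<le> i" "i < r + k" for i
    proof
      fix w assume "w \<in> {w \<in> ?W. adj ?G (?f i) w}"
      then obtain j where j: "j < r" "w = ?f j" and adj: "adj ?G (?f i) (?f j)" by auto
      have "j < i" using j i by simp
      have "i = 4 * (i div 4) + i mod 4" "j = 4 * (j div 4) + j mod 4" "i mod 4 < 4" "j mod 4 < 4"
        by simp_all
      then obtain t s t' s' where eq: "i = 4 * t + s" "j = 4 * t' + s'" and s: "s < 4" "s' < 4"
        by blast
      have fi: "?f i = (t, s)" "?f j = (t', s')" using eq s by auto
      have "(t = t' \<and> cyc s s') \<or> (s = s' \<and> (t = t' + 1 \<or> t = t' + m))"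
        using adj \<open>j < i\<close> eq m unfolding fi block_adj by auto
      then consider "t = t'" "cyc s s'" | "s = s'" "t = t' + 1" | "s = s'" "t = t' + m" by blast
      then show "w \<in> set (nb i)"
      proof cases
        case 1
        have "i < r + (k - 2)" using 1 j(1) eq s k by simp
        moreover have "s' = (i + 1) mod 4 \<or> s' = (i + 3) mod 4"
          using 1(2) unfolding eq(1) cyc_def by auto
        ultimately show ?thesis using fi 1 j(2) by (auto simp: nb_def)
      next
        case 2
        have "i < r + (k - 1)" using 2 j(1) eq k by simp
        then show ?thesis using fi 2 j(2) by (auto simp: nb_def)
      next
        case 3
        then show ?thesis using fi j(2) by (auto simp: nb_def)
      qed
    qed
    obtain c' where "forest_colouring ?G L (?W \<union> set (map ?f [r..<r + k])) ((r + k - 1) div k + 1) c'"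
    proof (rule extend_group[OF c block_adj_sym,
          where ys = "map ?f [r..<r + k]" and k = k and nbs = "map nb [r..<r + k]"])
      show "?W \<inter> set (map ?f [r..<r + k]) = {}"
        unfolding set_map set_upt inj_on_image_Int[OF injon subset_UNIV subset_UNIV, symmetric]
        by auto
      show "list_all2 (\<lambda>y xs. {w \<in> ?W. adj ?G y w} \<subseteq> set xs) (map ?f [r..<r + k]) (map nb [r..<r + k])"
        using W by (simp add: list_all2_conv_all_nth)
      show "length (map nb [r..<r + k] ! j) < 2 * (k - j)" if "j < length (map ?f [r..<r + k])" for j
        using that k by (auto simp: nb_def)
      show "finite (L y) \<and> card (L y) = k" if "y \<in> set (map ?f [r..<r + k])" for y
        using that less.prems n by auto
    qed (auto simp: distinct_map injon)
    moreover have "?W \<union> set (map ?f [r..<r + k]) = ?f ` {..<n}"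
      unfolding set_map set_upt n image_Un[symmetric] by (rule arg_cong[where f = "(`) ?f"]) auto
    moreover have "(r + k - 1) div k + 1 = (n + k - 1) div k"
      using k n div_add_self2[of k "r + k - 1"] by (simp add: add.commute)
    ultimately show ?thesis by metis
  qed
qed

lemma blocks_colouring:
  assumes m: "m \<ge> 1" and k: "k \<ge> 3" and L: "\<And>v. v \<in> blocks n \<Longrightarrow> finite (L v) \<and> card (L v) = k"
  shows "\<exists>c. forest_colouring (block_graph m) L (blocks n) ((4 * n + k - 1) div k) c"
proof -
  consider "k = 3" | "k = 4" | "k \<ge> 5" using k by linarith
  then show ?thesis
  proof cases
    case 1
    then show ?thesis using blocks_colouring_3[OF m, of n L] L by simp
  next
    case 2
    then have "(4 * n + k - 1) div k = n" by simp
    then show ?thesis using blocks_colouring_4[OF m, of n L] L 2 by simp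
  next
    case 3
    have "(i div 4, i mod 4) \<in> blocks n" if "i < 4 * n" for i
      using that by (auto simp: less_mult_imp_div_less mult.commute)
    moreover have "(t, s) \<in> (\<lambda>i. (i div 4, i mod 4)) ` {..<4 * n}" if "t < n" "s < 4" for t s :: nat
      by (rule image_eqI[of _ _ "4 * t + s"]) (use that in auto)
    ultimately have "(\<lambda>i. (i div 4, i mod 4)) ` {..<4 * n} = blocks n" by auto
    then show ?thesis using window_colouring[OF m 3, of "4 * n" L] L by auto
  qed
qed

section \<open>Transfer to the product of paths\<close>

text \<open>Row-major numbering of the copies; the second component runs around the four-cycle as
  00, 01, 11, 10.\<close>

definition block_position :: "nat \<Rightarrow> nat \<times> nat \<times> nat \<times> nat \<Rightarrow> nat \<times> nat" where
  "block_position m = (\<lambda>(x, y, i, j). (i * m + j, if x = 0 then y else 3 - y))"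

lemma bij_betw_block_position:
  "bij_betw (block_position m) ({..<2} \<times> {..<2} \<times> {..<n} \<times> {..<m}) (blocks (n * m))"
proof (rule bij_betw_imageI)
  show "inj_on (block_position m) ({..<2} \<times> {..<2} \<times> {..<n} \<times> {..<m})"
  proof (rule inj_onI)
    fix p p' assume "p \<in> {..<2} \<times> {..<2} \<times> {..<n} \<times> {..<m}" "p' \<in> {..<2} \<times> {..<2} \<times> {..<n} \<times> {..<m}"
      and eq': "block_position m p = block_position m p'"
    then obtain x y i j x' y' i' j' where p: "p = (x, y, i, j)" "p' = (x', y', i', j')"
      and lt: "x < 2" "y < 2" "x' < 2" "y' < 2" "j < m" "j' < m" by auto
    note eq = eq'[unfolded p]
    have "i * m + j = i' * m + j'" using eq by (simp add: block_position_def)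
    then have "(i * m + j) div m = (i' * m + j') div m" "(i * m + j) mod m = (i' * m + j') mod m"
      by simp_all
    then have "i = i'" "j = j'" using lt(5,6) by auto
    moreover have "x = x' \<and> y = y'"
      using eq lt(1-4) by (auto simp: block_position_def less_2_cases_iff split: if_splits)
    ultimately show "p = p'" using p by simp
  qed
  show "block_position m ` ({..<2} \<times> {..<2} \<times> {..<n} \<times> {..<m}) = blocks (n * m)"
  proof (rule equalityI; rule subsetI)
    fix p assume "p \<in> block_position m ` ({..<2} \<times> {..<2} \<times> {..<n} \<times> {..<m})"
    then obtain x y i j where p: "p = block_position m (x, y, i, j)" "x < 2" "y < 2" "i < n" "j < m"
      by auto
    have "i * m + j < Suc i * m" using p by simp
    also have "\<dots> \<le> n * m" using p by (intro mult_le_mono1) simp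
    finally show "p \<in> blocks (n * m)" using p by (auto simp: block_position_def)
  next
    fix p assume "p \<in> blocks (n * m)"
    then obtain t s where p: "p = (t, s)" "t < n * m" "s < 4" by auto
    have "m > 0" using p(2) by (cases m) auto
    have ts: "t div m < n" "t mod m < m" "t div m * m + t mod m = t"
      using p(2) \<open>m > 0\<close> by (simp_all add: less_mult_imp_div_less)
    have "p = block_position m (if s < 2 then 0 else 1, if s < 2 then s else 3 - s, t div m, t mod m)"
      using p ts(3) by (auto simp: block_position_def)
    moreover have "(if s < 2 then 0 else 1 :: nat, if s < 2 then s else 3 - s, t div m, t mod m)
        \<in> {..<2} \<times> {..<2} \<times> {..<n} \<times> {..<m}" using ts p(3) by auto
    ultimately show "p \<in> block_position m ` ({..<2} \<times> {..<2} \<times> {..<n} \<times> {..<m})" by blast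
  qed
qed

text \<open>Injective maps preserving adjacency send cycles to cycles. Non-adjacency may be lost, so
  the extra edges between rows are admissible.\<close>

lemma acyclic_induced_pullback:
  assumes ac: "acyclic_graph (induced_subgraph H T)"
    and f: "inj_on f S" "f ` S \<subseteq> T" "f ` S \<subseteq> verts H"
    and adj: "\<And>x y. adj G x y \<Longrightarrow> adj H (f x) (f y)"
  shows "acyclic_graph (induced_subgraph G S)"
  unfolding acyclic_graph_def
proof
  assume "\<exists>p. is_cycle (induced_subgraph G S) p"
  then obtain p where p: "is_cycle (induced_subgraph G S) p" by blast
  then have sub: "set p \<subseteq> S" and ne: "p \<noteq> []" by (auto simp: is_cycle_def induced_subgraph_def)
  have "is_cycle (induced_subgraph H T) (map f p)"
    using p sub ne f adj inj_on_subset[OF f(1) sub]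
    by (auto simp: is_cycle_def induced_subgraph_def distinct_map last_map hd_map image_subset_iff
        subset_iff)
  then show False using ac by (auto simp: acyclic_graph_def)
qed

text \<open>The quotient is an integer below \<open>n / k + 1\<close>.\<close>

lemma div_le_ceiling_divide: "int ((n + k - 1) div k) \<le> \<lceil>real n / real k\<rceil>" if "k > 0"
proof -
  have "real k * real ((n + k - 1) div k) \<le> real (n + k - 1)"
    by (metis of_nat_le_iff of_nat_mult times_div_less_eq_dividend)
  also have "\<dots> < real n + real k" using that by auto
  finally have "real ((n + k - 1) div k) - 1 < real n / real k"
    using that by (simp add: field_simps)
  then show ?thesis by linarith
qed

theorem theorem11:
  fixes n\<^sub>3 n\<^sub>4 k :: nat
  assumes "k \<ge> 3"
  shows "equitably_list_arborable TYPE('c) k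
           (path_graph 2 \<box> path_graph 2 \<box> path_graph n\<^sub>3 \<box> path_graph n\<^sub>4)"
  unfolding equitably_list_arborable_def
proof (intro allI impI)
  let ?P = "path_graph 2 \<box> path_graph 2 \<box> path_graph n\<^sub>3 \<box> path_graph n\<^sub>4"
  let ?H = "block_graph n\<^sub>4"
  let ?f = "block_position n\<^sub>4"
  let ?n = "n\<^sub>3 * n\<^sub>4"
  fix L :: "nat \<times> nat \<times> nat \<times> nat \<Rightarrow> 'c set"
  assume L: "uniform_list_assignment k ?P L"
  have V: "verts ?P = {..<2} \<times> {..<2} \<times> {..<n\<^sub>3} \<times> {..<n\<^sub>4}"
    by (simp add: cartesian_product_def path_graph_def)
  have bij: "bij_betw ?f (verts ?P) (blocks ?n)"
    unfolding V by (rule bij_betw_block_position)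
  then have inj: "inj_on ?f (verts ?P)" and img: "?f ` verts ?P = blocks ?n"
    by (auto simp: bij_betw_def)
  have cardV: "card (verts ?P) = 4 * ?n" by (simp add: V)
  \<comment> \<open>An edge changes one coordinate by 1: in the first two this is a step around the
    four-cycle, in the others a move by \<open>n\<^sub>4\<close> copies or by one.\<close>
  have adj: "adj ?H (?f x) (?f y)" if "adj ?P x y" for x y
  proof -
    obtain a b i j where x: "x = (a, b, i, j)" by (cases x)
    obtain a' b' i' j' where y: "y = (a', b', i', j')" by (cases y)
    from that have "a = 0 \<or> a = 1" "b = 0 \<or> b = 1" "a' = 0 \<or> a' = 1" "b' = 0 \<or> b' = 1"
      and "a = a' \<and> b = b' \<and> (i = i' \<and> (j' = Suc j \<or> j = Suc j') \<or>
          j = j' \<and> (i' = Suc i \<or> i = Suc i')) \<or>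
        i = i' \<and> j = j' \<and> (a = a' \<and> b \<noteq> b' \<or> a \<noteq> a' \<and> b = b')"
      unfolding x y by (auto simp: cartesian_product_def path_graph_def)
    then show ?thesis
      unfolding x y block_position_def block_adj prod.case
      by (elim disjE conjE) (simp_all add: cyc_def)
  qed
  \<comment> \<open>The lists are carried to the block graph along the inverse of the
    bijection.\<close>
  let ?L = "\<lambda>v. L (inv_into (verts ?P) ?f v)"
  have "\<exists>c. forest_colouring ?H ?L (blocks ?n) ((4 * ?n + k - 1) div k) c"
  \<comment> \<open>\<open>blocks_colouring\<close> requires positive row length; with rows of
    length 0 there are no vertices.\<close>
  proof (cases "n\<^sub>4 = 0")
    case True
    then have "blocks ?n = {}" by simp
    then show ?thesis using forest_colouring_empty[of ?H ?L] assms True by auto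
  next
    case False
    have "finite (?L v) \<and> card (?L v) = k" if "v \<in> blocks ?n" for v
      using L that inv_into_into[of v ?f "verts ?P"] img
      by (auto simp: uniform_list_assignment_def)
    then show ?thesis using False assms by (intro blocks_colouring) auto
  qed
  then obtain c where c: "\<And>v. v \<in> blocks ?n \<Longrightarrow> c v \<in> ?L v"
    and ac: "\<And>a. acyclic_graph (induced_subgraph ?H {v \<in> blocks ?n. c v = a})"
    and cd: "\<And>a. card {v \<in> blocks ?n. c v = a} \<le> (4 * ?n + k - 1) div k"
    unfolding forest_colouring_def by blast
  have cls: "inj_on ?f (colour_class ?P (c \<circ> ?f) a)"
    "?f ` colour_class ?P (c \<circ> ?f) a = {v \<in> blocks ?n. c v = a}" for a
  proof -
    show "inj_on ?f (colour_class ?P (c \<circ> ?f) a)"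
      by (rule inj_on_subset[OF inj]) (auto simp: colour_class_def)
    show "?f ` colour_class ?P (c \<circ> ?f) a = {v \<in> blocks ?n. c v = a}"
      unfolding colour_class_def img[symmetric] by auto
  qed
  have "list_colouring ?P L (c \<circ> ?f)"
    unfolding list_colouring_def
  proof
    fix v assume v: "v \<in> verts ?P"
    then have "c (?f v) \<in> ?L (?f v)" by (intro c) (use img in blast)
    then show "(c \<circ> ?f) v \<in> L v" using inv_into_f_f[OF inj v] by simp
  qed
  moreover have "equitable_colouring k ?P (c \<circ> ?f)"
    unfolding equitable_colouring_def
  proof
    fix a
    have "card (colour_class ?P (c \<circ> ?f) a) \<le> (4 * ?n + k - 1) div k"
      using cd[of a] card_image[OF cls(1)[of a]] cls(2)[of a] by simp
    also have "int \<dots> \<le> \<lceil>real (4 * ?n) / real k\<rceil>"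
      by (rule div_le_ceiling_divide) (use assms in simp)
    finally show "int (card (colour_class ?P (c \<circ> ?f) a)) \<le> \<lceil>real (card (verts ?P)) / real k\<rceil>"
      unfolding cardV by simp
  qed
  moreover have "acyclic_graph (induced_subgraph ?P (colour_class ?P (c \<circ> ?f) a))" for a
    by (rule acyclic_induced_pullback[OF ac[of a] cls(1) _ _ adj])
      (use cls(2)[of a] in \<open>auto simp: block_graph_def\<close>)
  ultimately show "\<exists>c. list_colouring ?P L c \<and> equitable_colouring k ?P c \<and>
      (\<forall>a. acyclic_graph (induced_subgraph ?P (colour_class ?P c a)))" by blast
qed

end
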